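(* For any integers $n\ge 1$, $k\geq 1$ and $d \ge 1$, the majority function $\mathrm{Maj}_n:\{0,1\}^n\to\{0,1\}$ satisfies $$\gamma_{d,k}(\mathrm{Maj}_n) \leq \frac{1}{2} + \frac{10d}{\sqrt{n}}.$$
   Context: $\mathrm{Maj}_n(x)=1$ iff the Hamming weight $|x|$ of $x$ satisfies $|x|>n/2$. For a Boolean function $F:\{0,1\}^n\to\{0,1\}$ and $k\ge 1$, the $k$-lift of $F$ is $F_k:\{0,1\}^n\to \mathbb{Z}/2^k\mathbb{Z}$ with $F_k(x)=0$ if $F(x)=0$ and $F_k(x)=2^{k-1}$ if $F(x)=1$. $\mathcal{P}_{d,k}$ denotes the set of multilinear polynomials in $x_1,\dots,x_n$ of degree at most $d$ with coefficients in $\mathbb{Z}/2^k\mathbb{Z}$, evaluated on $\{0,1\}^n$. $\mathrm{agr}(F,G)=\Pr_{x}[F(x)=G(x)]$ for $x$ uniform in $\{0,1\}^n$, and $\gamma_{d,k}(F)=\max_{Q\in\mathcal{P}_{d,k}}\mathrm{agr}(F_k,Q)$. *)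

theory Defs
  imports "HOL-Probability.Probability" "HOL-Number_Theory.Residues" "HOL-Library.FuncSet"
begin

definition cube :: "nat \<Rightarrow> (nat \<Rightarrow> int) set" where
  "cube n = {1..n} \<rightarrow>\<^sub>E {0, 1}"

definition hamming_weight :: "nat \<Rightarrow> (nat \<Rightarrow> int) \<Rightarrow> nat" where
  "hamming_weight n x = card {i \<in> {1..n}. x i = 1}"

text \<open>Boolean functions on the cube take values in \<^typ>\<open>bool\<close>, with \<^const>\<open>True\<close> for 1 and
  \<^const>\<open>False\<close> for 0; only their values on \<^term>\<open>cube n\<close> matter.\<close>

definition Maj :: "nat \<Rightarrow> (nat \<Rightarrow> int) \<Rightarrow> bool" where
  "Maj n x \<longleftrightarrow> real (hamming_weight n x) > real n / 2"

abbreviation Z2 :: "nat \<Rightarrow> int ring" where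
  "Z2 k \<equiv> residue_ring (2 ^ k)"

definition lift :: "nat \<Rightarrow> ((nat \<Rightarrow> int) \<Rightarrow> bool) \<Rightarrow> (nat \<Rightarrow> int) \<Rightarrow> int" where
  "lift k F x = (if F x then 2 ^ (k - 1) else 0)"

text \<open>A multilinear polynomial in the variables \<open>x\<^sub>1, \<dots>, x\<^sub>n\<close> is given by its coefficient function:
  \<open>c S\<close> is the coefficient of the monomial \<open>\<Prod>i\<in>S. x\<^sub>i\<close>.\<close>

definition mlpolys :: "nat \<Rightarrow> nat \<Rightarrow> nat \<Rightarrow> (nat set \<Rightarrow> int) set" where
  "mlpolys n d k = {c. (\<forall>S. c S \<in> carrier (Z2 k)) \<and>
     (\<forall>S. c S \<noteq> \<zero>\<^bsub>Z2 k\<^esub> \<longrightarrow> S \<subseteq> {1..n} \<and> card S \<le> d)}"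

definition mleval :: "nat \<Rightarrow> nat \<Rightarrow> (nat set \<Rightarrow> int) \<Rightarrow> (nat \<Rightarrow> int) \<Rightarrow> int" where
  "mleval n k c x = (\<Oplus>\<^bsub>Z2 k\<^esub>S\<in>Pow {1..n}. c S \<otimes>\<^bsub>Z2 k\<^esub> (\<Otimes>\<^bsub>Z2 k\<^esub>i\<in>S. x i))"

definition agr :: "nat \<Rightarrow> ((nat \<Rightarrow> int) \<Rightarrow> 'a) \<Rightarrow> ((nat \<Rightarrow> int) \<Rightarrow> 'a) \<Rightarrow> real" where
  "agr n F G = measure_pmf.prob (pmf_of_set (cube n)) {x. F x = G x}"

definition max_agr :: "nat \<Rightarrow> nat \<Rightarrow> nat \<Rightarrow> ((nat \<Rightarrow> int) \<Rightarrow> bool) \<Rightarrow> real" where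
  "max_agr n d k F = Max ((\<lambda>Q. agr n (lift k F) (mleval n k Q)) ` mlpolys n d k)"

text \<open>The maximum is over a finite nonempty set, and evaluation is integer evaluation modulo
  \<open>2 ^ k\<close>.\<close>

lemma finite_cube: "finite (cube n)"
  unfolding cube_def by (intro finite_PiE) auto

lemma cube_nonempty: "cube n \<noteq> {}"
  unfolding cube_def by (simp add: PiE_eq_empty_iff)

lemma agr_eq_card: "agr n F G = card {x \<in> cube n. F x = G x} / card (cube n)"
proof -
  have "cube n \<inter> {x. F x = G x} = {x \<in> cube n. F x = G x}" by auto
  then show ?thesis
    unfolding agr_def by (simp add: measure_pmf_of_set finite_cube cube_nonempty)
qed

lemma finite_mlpolys: "finite (mlpolys n d k)"
proof (rule finite_subset)
  show "mlpolys n d k \<subseteq>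
    {c. \<forall>S. (S \<in> Pow {1..n} \<longrightarrow> c S \<in> {0..2 ^ k - 1}) \<and> (S \<notin> Pow {1..n} \<longrightarrow> c S = 0)}"
    unfolding mlpolys_def by (auto simp: residue_ring_def)
  show "finite {c :: nat set \<Rightarrow> int.
    \<forall>S. (S \<in> Pow {1..n} \<longrightarrow> c S \<in> {0..2 ^ k - 1}) \<and> (S \<notin> Pow {1..n} \<longrightarrow> c S = 0)}"
    by (rule finite_set_of_finite_funs) auto
qed

lemma mlpolys_nonempty: "mlpolys n d k \<noteq> {}"
proof -
  have "(\<lambda>_. 0) \<in> mlpolys n d k"
    unfolding mlpolys_def by (auto simp: residue_ring_def)
  then show ?thesis by blast
qed

lemma mleval_eq_mod:
  assumes k: "k \<ge> 1" and c: "c \<in> mlpolys n d k" and x: "x \<in> cube n"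
  shows "mleval n k c x = (\<Sum>S\<in>Pow {1..n}. c S * (\<Prod>i\<in>S. x i)) mod 2 ^ k"
proof -
  have "(2::int) ^ 1 \<le> 2 ^ k" using k by (intro power_increasing) auto
  then have m1: "(1::int) < 2 ^ k" by simp
  interpret residues "2 ^ k" "Z2 k"
    using m1 by unfold_locales auto
  have P: "(\<Otimes>\<^bsub>Z2 k\<^esub>i\<in>S. x i) = (\<Prod>i\<in>S. x i) mod 2 ^ k" if "S \<subseteq> {1..n}" for S
  proof -
    have "x i mod 2 ^ k = x i" if "i \<in> S" for i
    proof -
      from that \<open>S \<subseteq> {1..n}\<close> x have "x i \<in> {0, 1}" unfolding cube_def by auto
      then show ?thesis using m1 k by auto
    qed
    moreover have "x i \<in> carrier (Z2 k)" if "i \<in> S" for i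
    proof -
      from that \<open>S \<subseteq> {1..n}\<close> x have "x i \<in> {0, 1}" unfolding cube_def by auto
      then show ?thesis using m1 by (auto simp: residue_ring_def)
    qed
    ultimately have "(\<Otimes>\<^bsub>Z2 k\<^esub>i\<in>S. x i) = (\<Otimes>\<^bsub>Z2 k\<^esub>i\<in>S. x i mod 2 ^ k)"
      by (intro finprod_cong') auto
    also have "\<dots> = (\<Prod>i\<in>S. x i) mod 2 ^ k"
      using that finite_subset by (intro prod_cong) auto
    finally show ?thesis .
  qed
  have "mleval n k c x = (\<Oplus>\<^bsub>Z2 k\<^esub>S\<in>Pow {1..n}. (c S * (\<Prod>i\<in>S. x i)) mod 2 ^ k)"
    unfolding mleval_def
    by (intro finsum_cong') (auto simp: P res_mult_eq mod_mult_right_eq)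
  also have "\<dots> = (\<Sum>S\<in>Pow {1..n}. c S * (\<Prod>i\<in>S. x i)) mod 2 ^ k"
    by (intro sum_cong) auto
  finally show ?thesis .
qed

end

theory Submission
  imports Defs
begin

text \<open>
  Let \<open>A\<close> be the set of points where \<open>Q\<close> agrees with the lift of majority.  Any function on the
  points of weight at most \<open>n/2\<close>, and any function on the points of weight more than \<open>n/2\<close>, is an
  integer polynomial \<open>p\<close> of degree at most \<open>n/2\<close>.  For \<open>y \<in> A\<close>, interpolate the indicator of \<open>y\<close>
  on its own half by \<open>p\<close>; then \<open>Q p\<close> or \<open>(2^(k-1) - Q) p\<close> is congruent modulo \<open>2^k\<close> on \<open>A\<close> to
  \<open>2^(k-1)\<close> times the indicator of \<open>y\<close>, and has degree at most \<open>n/2 + d\<close>.  If \<open>A\<close> had more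
  points than there are monomials of that degree, some integer weight on \<open>A\<close> with an odd value
  \<open>w y\<close> would annihilate all these polynomials; pairing it with the above one yields
  \<open>2^(k-1) w y \<equiv> 0\<close> modulo \<open>2^k\<close>, which is absurd.  Hence \<open>A\<close> has at most
  \<open>\<Sum>i\<le>n/2+d. n choose i\<close> elements.
\<close>

section \<open>Underdetermined integer systems\<close>

text \<open>Gaussian elimination by induction on the equations, made fraction-free by
  cross-multiplication so that the solution stays integral.\<close>

lemma homogeneous_system_nonzero_solution:
  fixes a :: "'m \<Rightarrow> 'x \<Rightarrow> int"
  assumes "finite M" "finite X" "card M < card X"
  shows "\<exists>w. (\<exists>x\<in>X. w x \<noteq> 0) \<and> (\<forall>m\<in>M. (\<Sum>x\<in>X. w x * a m x) = 0)"
  using assms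
proof (induction M arbitrary: X a rule: finite_induct)
  case empty
  then have "X \<noteq> {}" by auto
  then show ?case by (intro exI[of _ "\<lambda>_. 1"]) auto
next
  case (insert m M)
  show ?case
  proof (cases "\<forall>x\<in>X. a m x = 0")
    case True
    have "card M < card X" using insert by simp
    with insert.IH[OF insert.prems(1), of a] True show ?thesis by auto
  next
    case False
    then obtain x0 where x0: "x0 \<in> X" "a m x0 \<noteq> 0" by blast
    define X' where "X' = X - {x0}"
    have X': "finite X'" "card M < card X'" "X = insert x0 X'" "x0 \<notin> X'"
      using insert x0 by (auto simp: X'_def)
    \<comment> \<open>Equation \<open>m'\<close> with \<open>x0\<close> eliminated by means of the
      pivot \<open>a m x0\<close>.\<close>
    define a' where "a' m' x = a m x0 * a m' x - a m x * a m' x0" for m' x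
    obtain w' where w': "\<exists>x\<in>X'. w' x \<noteq> 0" "\<forall>m\<in>M. (\<Sum>x\<in>X'. w' x * a' m x) = 0"
      using insert.IH[OF X'(1,2), of a'] by blast
    \<comment> \<open>Scaling \<open>w'\<close> by the pivot makes the value at \<open>x0\<close>
      that solves equation \<open>m\<close> an integer.\<close>
    define w where "w x = (if x = x0 then - (\<Sum>x\<in>X'. w' x * a m x) else a m x0 * w' x)" for x
    have sum_w: "(\<Sum>x\<in>X. w x * b x) =
        a m x0 * (\<Sum>x\<in>X'. w' x * b x) - (\<Sum>x\<in>X'. w' x * a m x) * b x0" for b
    proof -
      have "(\<Sum>x\<in>X'. w x * b x) = (\<Sum>x\<in>X'. a m x0 * (w' x * b x))"
        using X'(4) by (intro sum.cong) (auto simp: w_def)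
      then show ?thesis
        using X' by (simp add: w_def sum_distrib_left)
    qed
    have "(\<Sum>x\<in>X. w x * a m' x) = 0" if "m' \<in> insert m M" for m'
    proof (cases "m' = m")
      case True
      then show ?thesis unfolding sum_w by simp
    next
      case False
      with that w'(2) have "(\<Sum>x\<in>X'. w' x * a' m' x) = 0" by auto
      moreover have "(\<Sum>x\<in>X'. w' x * a' m' x) =
          a m x0 * (\<Sum>x\<in>X'. w' x * a m' x) - (\<Sum>x\<in>X'. w' x * a m x) * a m' x0"
        by (simp add: a'_def sum_distrib_left sum_distrib_right sum_subtractf algebra_simps)
      ultimately show ?thesis unfolding sum_w by simp
    qed
    moreover have "\<exists>x\<in>X. w x \<noteq> 0"
      using w'(1) x0 X' by (auto simp: w_def)
    ultimately show ?thesis by blast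
  qed
qed

text \<open>Dividing a nonzero solution by the gcd of its values leaves a solution whose values are
  not all even. Oddness is what later survives multiplication by \<open>2 ^ (k - 1)\<close> modulo
  \<open>2 ^ k\<close>.\<close>

lemma homogeneous_system_odd_solution:
  fixes a :: "'m \<Rightarrow> 'x \<Rightarrow> int"
  assumes "finite M" "finite X" "card M < card X"
  obtains w y where "y \<in> X" "odd (w y)" "\<And>m. m \<in> M \<Longrightarrow> (\<Sum>x\<in>X. w x * a m x) = 0"
proof -
  obtain w where w: "\<exists>x\<in>X. w x \<noteq> 0" "\<forall>m\<in>M. (\<Sum>x\<in>X. w x * a m x) = 0"
    using homogeneous_system_nonzero_solution[OF assms, of a] by blast
  define g where "g = Gcd (w ` X)"
  have g0: "g \<noteq> 0" using w(1) by (auto simp: g_def)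
  define v where "v x = w x div g" for x
  have wv: "w x = g * v x" if "x \<in> X" for x
    using that by (simp add: v_def g_def)
  have "\<exists>y\<in>X. odd (v y)"
  proof (rule ccontr)
    assume "\<not> (\<exists>y\<in>X. odd (v y))"
    then have "g * 2 dvd w x" if "x \<in> X" for x
      using that wv by (auto intro: mult_dvd_mono)
    then have "g * 2 dvd Gcd (w ` X)" by (intro Gcd_greatest) blast
    then have "g * 2 dvd g * 1" by (simp add: g_def)
    with g0 show False by (simp only: dvd_mult_cancel_left) auto
  qed
  moreover have "(\<Sum>x\<in>X. v x * a m x) = 0" if "m \<in> M" for m
  proof -
    have "g * (\<Sum>x\<in>X. v x * a m x) = (\<Sum>x\<in>X. w x * a m x)"
      by (simp add: sum_distrib_left wv mult.assoc)
    then show ?thesis using w(2) g0 that by simp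
  qed
  ultimately show ?thesis using that by blast
qed

section \<open>Integer polynomial functions on the cube\<close>

definition monomials :: "nat \<Rightarrow> nat \<Rightarrow> nat set set" where
  "monomials n D = {S. S \<subseteq> {1..n} \<and> card S \<le> D}"

text \<open>Coefficients are integers, not residues, so annihilation is exact and congruences enter
  only at the end. Functions are compared on the cube alone.\<close>

definition polyfun :: "nat \<Rightarrow> nat \<Rightarrow> ((nat \<Rightarrow> int) \<Rightarrow> int) set" where
  "polyfun n D = {f. \<exists>c. \<forall>x\<in>cube n. f x = (\<Sum>S\<in>monomials n D. c S * (\<Prod>i\<in>S. x i))}"

lemma finite_monomials: "finite (monomials n D)"
  unfolding monomials_def by simp

lemma card_monomials: "card (monomials n D) = (\<Sum>i\<le>D. n choose i)"
proof -
  have "monomials n D = (\<Union>i\<le>D. {S. S \<subseteq> {1..n} \<and> card S = i})"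
    by (auto simp: monomials_def)
  also have "card \<dots> = (\<Sum>i\<le>D. card {S. S \<subseteq> {1..n} \<and> card S = i})"
    by (intro card_UN_disjoint) auto
  also have "\<dots> = (\<Sum>i\<le>D. n choose i)"
    by (simp add: n_subsets)
  finally show ?thesis .
qed

lemma cube_cases: "x \<in> cube n \<Longrightarrow> i \<in> {1..n} \<Longrightarrow> x i = 0 \<or> x i = 1"
  unfolding cube_def by (auto dest: PiE_mem)

lemma polyfun_cong: "f \<in> polyfun n D \<Longrightarrow> (\<And>x. x \<in> cube n \<Longrightarrow> g x = f x) \<Longrightarrow> g \<in> polyfun n D"
  unfolding polyfun_def by auto

lemma polyfun_monomial: "S \<in> monomials n D \<Longrightarrow> (\<lambda>x. \<Prod>i\<in>S. x i) \<in> polyfun n D"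
  unfolding polyfun_def
  by (auto intro!: exI[of _ "\<lambda>T. of_bool (T = S)"] simp: finite_monomials if_distrib cong: if_cong)

lemma polyfun_add:
  assumes "f \<in> polyfun n D" "g \<in> polyfun n D"
  shows "(\<lambda>x. f x + g x) \<in> polyfun n D"
proof -
  obtain c e where
    "\<forall>x\<in>cube n. f x = (\<Sum>S\<in>monomials n D. c S * (\<Prod>i\<in>S. x i))"
    "\<forall>x\<in>cube n. g x = (\<Sum>S\<in>monomials n D. e S * (\<Prod>i\<in>S. x i))"
    using assms unfolding polyfun_def by blast
  then show ?thesis
    unfolding polyfun_def
    by (auto intro!: exI[of _ "\<lambda>S. c S + e S"] simp: sum.distrib algebra_simps)
qed

lemma polyfun_cmult:
  assumes "f \<in> polyfun n D"
  shows "(\<lambda>x. a * f x) \<in> polyfun n D"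
proof -
  obtain c where "\<forall>x\<in>cube n. f x = (\<Sum>S\<in>monomials n D. c S * (\<Prod>i\<in>S. x i))"
    using assms unfolding polyfun_def by blast
  then show ?thesis
    unfolding polyfun_def
    by (auto intro!: exI[of _ "\<lambda>S. a * c S"] simp: sum_distrib_left algebra_simps)
qed

lemma polyfun_const: "(\<lambda>_. a) \<in> polyfun n D"
  using polyfun_cmult[OF polyfun_monomial[of "{}" n D], of a] by (simp add: monomials_def)

lemma polyfun_sum:
  assumes "\<And>s. s \<in> I \<Longrightarrow> f s \<in> polyfun n D"
  shows "(\<lambda>x. \<Sum>s\<in>I. f s x) \<in> polyfun n D"
  using assms
  by (induction I rule: infinite_finite_induct) (auto intro: polyfun_add polyfun_const)

text \<open>On 0/1 points \<open>x i * x i = x i\<close>, so the monomials of \<open>S\<close> and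
  \<open>T\<close> multiply to that of \<open>S \<union> T\<close>, of size at most
  \<open>card S + card T\<close>.\<close>

lemma polyfun_mult:
  assumes "f \<in> polyfun n D" "g \<in> polyfun n E"
  shows "(\<lambda>x. f x * g x) \<in> polyfun n (D + E)"
proof -
  obtain c e where c: "\<forall>x\<in>cube n. f x = (\<Sum>S\<in>monomials n D. c S * (\<Prod>i\<in>S. x i))"
    and e: "\<forall>x\<in>cube n. g x = (\<Sum>S\<in>monomials n E. e S * (\<Prod>i\<in>S. x i))"
    using assms unfolding polyfun_def by blast
  have union: "S \<union> T \<in> monomials n (D + E)" if "S \<in> monomials n D" "T \<in> monomials n E" for S T
    using that card_Un_le[of S T] by (auto simp: monomials_def)
  have prod: "(\<Prod>i\<in>S \<union> T. x i) = (\<Prod>i\<in>S. x i) * (\<Prod>i\<in>T. x i)"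
    if "S \<in> monomials n D" "T \<in> monomials n E" "x \<in> cube n" for S T x
  proof -
    have fin: "finite S" "finite T" using that by (auto simp: monomials_def intro: finite_subset)
    have "(\<Prod>i\<in>U. x i) = of_bool (\<forall>i\<in>U. x i = 1)" if "finite U" "U \<subseteq> {1..n}" for U
      using that cube_cases[OF \<open>x \<in> cube n\<close>] by induction auto
    moreover have "S \<subseteq> {1..n}" "T \<subseteq> {1..n}" using that by (auto simp: monomials_def)
    ultimately show ?thesis using fin by auto
  qed
  have "(\<lambda>x. \<Sum>S\<in>monomials n D. \<Sum>T\<in>monomials n E. c S * e T * (\<Prod>i\<in>S \<union> T. x i))
      \<in> polyfun n (D + E)"
    by (intro polyfun_sum polyfun_cmult polyfun_monomial union)
  then show ?thesis
    by (rule polyfun_cong) (auto simp: c e sum_product prod algebra_simps intro!: sum.cong)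
qed

lemma polyfun_coord: "i \<in> {1..n} \<Longrightarrow> (\<lambda>x. x i) \<in> polyfun n 1"
  using polyfun_monomial[of "{i}" n 1] by (simp add: monomials_def)

lemma polyfun_prod:
  assumes "finite U" "\<And>i. i \<in> U \<Longrightarrow> f i \<in> polyfun n 1"
  shows "(\<lambda>x. \<Prod>i\<in>U. f i x) \<in> polyfun n (card U)"
  using assms
proof (induction U rule: finite_induct)
  case empty
  show ?case using polyfun_const by simp
next
  case (insert j U)
  then have "(\<lambda>x. f j x * (\<Prod>i\<in>U. f i x)) \<in> polyfun n (1 + card U)"
    by (intro polyfun_mult) auto
  then show ?case using insert by simp
qed

lemma polyfun_mono:
  assumes "f \<in> polyfun n D" "D \<le> E"
  shows "f \<in> polyfun n E"
proof -
  \<comment> \<open>The constant 1 counts as a polynomial of degree at most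
    \<open>E - D\<close>.\<close>
  have "(\<lambda>x. f x * 1) \<in> polyfun n (D + (E - D))"
    by (intro polyfun_mult polyfun_const assms)
  then show ?thesis using assms by simp
qed

lemma polyfun_annihilated:
  assumes w: "\<And>S. S \<in> monomials n D \<Longrightarrow> (\<Sum>x\<in>A. w x * (\<Prod>i\<in>S. x i)) = 0"
    and f: "f \<in> polyfun n D" and A: "A \<subseteq> cube n"
  shows "(\<Sum>x\<in>A. w x * f x) = 0"
proof -
  obtain c where c: "\<forall>x\<in>cube n. f x = (\<Sum>S\<in>monomials n D. c S * (\<Prod>i\<in>S. x i))"
    using f unfolding polyfun_def by blast
  have "(\<Sum>x\<in>A. w x * f x) = (\<Sum>x\<in>A. \<Sum>S\<in>monomials n D. c S * (w x * (\<Prod>i\<in>S. x i)))"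
    using A c by (intro sum.cong) (auto simp: sum_distrib_left algebra_simps)
  also have "\<dots> = (\<Sum>S\<in>monomials n D. c S * (\<Sum>x\<in>A. w x * (\<Prod>i\<in>S. x i)))"
    by (subst sum.swap) (simp add: sum_distrib_left)
  finally show ?thesis using w by simp
qed

section \<open>Interpolation on the halves of the cube\<close>

text \<open>The cube point with support \<open>T\<close>; the restriction supplies the value
  \<open>undefined\<close> outside \<open>{1..n}\<close> that points of \<open>cube n\<close>
  have.\<close>

definition point :: "nat \<Rightarrow> nat set \<Rightarrow> nat \<Rightarrow> int" where
  "point n T = (\<lambda>i\<in>{1..n}. of_bool (i \<in> T))"

lemma point_support:
  assumes "x \<in> cube n"
  shows "point n {i \<in> {1..n}. x i = 1} = x"
proof
  fix i
  show "point n {i \<in> {1..n}. x i = 1} i = x i"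
  proof (cases "i \<in> {1..n}")
    case True
    then show ?thesis using cube_cases[OF assms True] by (auto simp: point_def)
  next
    case False
    then have "x i = undefined" using assms unfolding cube_def by (rule PiE_arb[rotated])
    then show ?thesis unfolding point_def using False by (simp only: restrict_apply if_False)
  qed
qed

text \<open>Induction over weight layers. At a point of weight at most \<open>m + 1\<close>, a
  monomial of size \<open>m + 1\<close> is 1 exactly when its index set is the support of the point.
  Such monomials therefore correct the new layer with integer coefficients and leave the lower
  layers untouched.\<close>

lemma interpolation_low:
  "\<exists>p\<in>polyfun n m. \<forall>x\<in>cube n. hamming_weight n x \<le> m \<longrightarrow> p x = f x"
proof (induction m)
  case 0
  have "f (point n {}) = f x" if "x \<in> cube n" "hamming_weight n x \<le> 0" for x
  proof -
    have "{i \<in> {1..n}. x i = 1} = {}"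
      using that(2) by (simp add: hamming_weight_def)
    then show ?thesis using point_support[OF that(1)] by metis
  qed
  then show ?case
    by (intro bexI[of _ "\<lambda>_. f (point n {})"]) (auto intro: polyfun_const)
next
  case (Suc m)
  then obtain p where p: "p \<in> polyfun n m"
      "\<And>x. x \<in> cube n \<Longrightarrow> hamming_weight n x \<le> m \<Longrightarrow> p x = f x"
    by blast
  define L where "L = {T. T \<subseteq> {1..n} \<and> card T = Suc m}"
  define q where "q x = p x + (\<Sum>T\<in>L. (f (point n T) - p (point n T)) * (\<Prod>i\<in>T. x i))" for x
  have finL: "finite L" by (simp add: L_def)
  have "q \<in> polyfun n (Suc m)"
    unfolding q_def[abs_def]
    by (intro polyfun_add polyfun_mono[OF p(1)] polyfun_sum polyfun_cmult polyfun_monomial)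
       (auto simp: L_def monomials_def)
  moreover have "q x = f x" if x: "x \<in> cube n" "hamming_weight n x \<le> Suc m" for x
  proof -
    define U where "U = {i \<in> {1..n}. x i = 1}"
    have U: "finite U" "card U \<le> Suc m" "U \<subseteq> {1..n}" "point n U = x"
      using x point_support[OF x(1)] by (auto simp: U_def hamming_weight_def)
    have mon: "(\<Prod>i\<in>T. x i) = of_bool (T = U)" if "T \<in> L" for T
    proof (cases "T = U")
      case True
      then show ?thesis by (auto simp: U_def intro!: prod.neutral)
    next
      case False
      have "\<not> T \<subseteq> U" using False that U card_seteq[of U T] by (auto simp: L_def)
      then obtain i where "i \<in> T" "i \<notin> U" by blast
      moreover from this that have "x i = 0"
        using cube_cases[OF x(1), of i] by (auto simp: U_def L_def)
      moreover have "finite T" using that by (auto simp: L_def intro: finite_subset)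
      ultimately show ?thesis using False by auto
    qed
    have "(\<Sum>T\<in>L. (f (point n T) - p (point n T)) * (\<Prod>i\<in>T. x i)) =
        (\<Sum>T\<in>L. if T = U then f x - p x else 0)"
      using U by (intro sum.cong) (auto simp: mon)
    also have "\<dots> = (if U \<in> L then f x - p x else 0)"
      using finL by simp
    finally have q: "q x = p x + (if U \<in> L then f x - p x else 0)"
      by (simp add: q_def)
    show ?thesis
    proof (cases "U \<in> L")
      case True
      then show ?thesis using q by simp
    next
      case False
      then have "hamming_weight n x \<le> m"
        using U x by (auto simp: L_def U_def hamming_weight_def)
      then show ?thesis using q False p(2) x by simp
    qed
  qed
  ultimately show ?case by blast
qed

text \<open>The reflection of the cube that exchanges weights \<open>h\<close> and
  \<open>n - h\<close>; it carries interpolation from light points to heavy ones.\<close>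

definition flip :: "nat \<Rightarrow> (nat \<Rightarrow> int) \<Rightarrow> nat \<Rightarrow> int" where
  "flip n x = (\<lambda>i\<in>{1..n}. 1 - x i)"

lemma flip_cube: "x \<in> cube n \<Longrightarrow> flip n x \<in> cube n"
  using cube_cases[of x n] by (fastforce simp: flip_def cube_def)

lemma flip_flip: "x \<in> cube n \<Longrightarrow> flip n (flip n x) = x"
  by (auto simp: flip_def cube_def fun_eq_iff PiE_def extensional_def)

lemma hamming_weight_flip:
  assumes "x \<in> cube n"
  shows "hamming_weight n (flip n x) + hamming_weight n x = n"
proof -
  have "{i \<in> {1..n}. flip n x i = 1} = {1..n} - {i \<in> {1..n}. x i = 1}"
    using cube_cases[OF assms] by (auto simp: flip_def)
  then have "hamming_weight n (flip n x) = n - hamming_weight n x"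
    unfolding hamming_weight_def by (simp only:) (subst card_Diff_subset; force)
  moreover have "hamming_weight n x \<le> n"
    using card_mono[of "{1..n}" "{i \<in> {1..n}. x i = 1}"] by (force simp: hamming_weight_def)
  ultimately show ?thesis by simp
qed

lemma polyfun_flip:
  assumes "f \<in> polyfun n D"
  shows "(\<lambda>x. f (flip n x)) \<in> polyfun n D"
proof -
  obtain c where c: "\<forall>x\<in>cube n. f x = (\<Sum>S\<in>monomials n D. c S * (\<Prod>i\<in>S. x i))"
    using assms unfolding polyfun_def by blast
  \<comment> \<open>Substituting \<open>1 - x i\<close> turns a monomial into a product of
    \<open>card S\<close> factors of degree 1. The form \<open>1 + (-1) * x i\<close> fits the
    closure rules for sums and scalar multiples.\<close>
  have "(\<lambda>x. \<Prod>i\<in>S. 1 + (-1) * x i) \<in> polyfun n D" if S: "S \<in> monomials n D" for S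
  proof (rule polyfun_mono)
    show "(\<lambda>x. \<Prod>i\<in>S. 1 + (-1) * x i) \<in> polyfun n (card S)"
      using S
      by (intro polyfun_prod polyfun_add polyfun_const polyfun_cmult polyfun_coord)
         (auto simp: monomials_def intro: finite_subset)
  qed (use S in \<open>auto simp: monomials_def\<close>)
  then have "(\<lambda>x. \<Sum>S\<in>monomials n D. c S * (\<Prod>i\<in>S. 1 + (-1) * x i)) \<in> polyfun n D"
    by (intro polyfun_sum polyfun_cmult)
  then show ?thesis
  proof (rule polyfun_cong)
    fix x assume x: "x \<in> cube n"
    have "(\<Prod>i\<in>S. flip n x i) = (\<Prod>i\<in>S. 1 + (-1) * x i)" if "S \<in> monomials n D" for S
      using that by (intro prod.cong) (auto simp: flip_def monomials_def)
    then show "f (flip n x) = (\<Sum>S\<in>monomials n D. c S * (\<Prod>i\<in>S. 1 + (-1) * x i))"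
      using c flip_cube[OF x] by simp
  qed
qed

text \<open>The reflection sends these points to weight at most \<open>m\<close>, so the low
  interpolant of the reflected \<open>f\<close> is reflected back.\<close>

lemma interpolation_high:
  "\<exists>p\<in>polyfun n m. \<forall>x\<in>cube n. n \<le> hamming_weight n x + m \<longrightarrow> p x = f x"
proof -
  obtain p where p: "p \<in> polyfun n m"
      "\<And>x. x \<in> cube n \<Longrightarrow> hamming_weight n x \<le> m \<Longrightarrow> p x = f (flip n x)"
    using interpolation_low[of n m "\<lambda>x. f (flip n x)"] by blast
  have "p (flip n x) = f x" if "x \<in> cube n" "n \<le> hamming_weight n x + m" for x
    using p(2)[OF flip_cube[OF that(1)]] hamming_weight_flip[OF that(1)] that
    by (simp add: flip_flip)
  then show ?thesis
    by (intro bexI[OF _ polyfun_flip[OF p(1)]]) auto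
qed

section \<open>The agreement set\<close>

lemma card_agreement_le:
  assumes k: "k \<ge> 1" and c: "c \<in> mlpolys n d k"
  defines "A \<equiv> {x \<in> cube n. lift k (Maj n) x = mleval n k c x}"
  shows "card A \<le> (\<Sum>i\<le>n div 2 + d. n choose i)"
proof (rule ccontr)
  assume neg: "\<not> ?thesis"
  have A: "A \<subseteq> cube n" "finite A"
    using finite_cube by (auto simp: A_def)
  have "card (monomials n (n div 2 + d)) < card A"
    using neg by (simp add: card_monomials)
  then obtain w y where y: "y \<in> A" "odd (w y)"
    and w: "\<And>S. S \<in> monomials n (n div 2 + d) \<Longrightarrow> (\<Sum>x\<in>A. w x * (\<Prod>i\<in>S. x i)) = 0"
    using homogeneous_system_odd_solution[OF finite_monomials A(2),
        where a = "\<lambda>S x. \<Prod>i\<in>S. x i"] by blast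
  \<comment> \<open>The integer value of the polynomial before reduction modulo
    \<open>2 ^ k\<close>.\<close>
  define Q where "Q x = (\<Sum>S\<in>Pow {1..n}. c S * (\<Prod>i\<in>S. x i))" for x :: "nat \<Rightarrow> int"
  have Q: "Q \<in> polyfun n d"
  proof -
    have "c S = 0" if "S \<in> Pow {1..n} - monomials n d" for S
      using c that by (auto simp: mlpolys_def monomials_def residue_ring_def)
    then have "Q x = (\<Sum>S\<in>monomials n d. c S * (\<Prod>i\<in>S. x i))" for x
      unfolding Q_def by (intro sum.mono_neutral_right) (auto simp: monomials_def)
    then show ?thesis by (auto simp: polyfun_def)
  qed
  have Q_cong: "[Q x = lift k (Maj n) x] (mod 2 ^ k)" if "x \<in> A" for x
    using that mleval_eq_mod[OF k c, of x] by (simp add: A_def Q_def cong_def)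
  \<comment> \<open>For either parity of \<open>n\<close>, light points have at most
    \<open>n div 2\<close> ones and heavy points at most \<open>n div 2\<close> zeros, so degree
    \<open>n div 2\<close> interpolates on each half.\<close>
  have low: "hamming_weight n x \<le> n div 2" if "\<not> Maj n x" for x
    using that by (simp add: Maj_def)
  have high: "n \<le> hamming_weight n x + n div 2" if "Maj n x" for x
    using that by (simp add: Maj_def)
  have "\<exists>P\<in>polyfun n (n div 2 + d). \<forall>x\<in>A. [P x = 2 ^ (k - 1) * of_bool (x = y)] (mod 2 ^ k)"
  proof (cases "Maj n y")
    case True
    obtain p where p: "p \<in> polyfun n (n div 2)"
      "\<And>x. x \<in> cube n \<Longrightarrow> n \<le> hamming_weight n x + n div 2 \<Longrightarrow> p x = of_bool (x = y)"
      using interpolation_high[of n "n div 2" "\<lambda>x. of_bool (x = y)"] by blast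
    \<comment> \<open>The values of \<open>p\<close> on light points are uncontrolled, but there
      \<open>Q\<close> is 0 modulo \<open>2 ^ k\<close> on \<open>A\<close>.\<close>
    have "[p x * Q x = 2 ^ (k - 1) * of_bool (x = y)] (mod 2 ^ k)" if "x \<in> A" for x
    proof -
      have "p x * lift k (Maj n) x = 2 ^ (k - 1) * of_bool (x = y)"
        using p(2)[of x] high[of x] True that A(1) by (auto simp: lift_def)
      then show ?thesis
        using cong_mult[OF cong_refl[of "p x"] Q_cong[OF that]] by simp
    qed
    then show ?thesis
      by (intro bexI[OF _ polyfun_mult[OF p(1) Q]]) auto
  next
    case False
    obtain p where p: "p \<in> polyfun n (n div 2)"
      "\<And>x. x \<in> cube n \<Longrightarrow> hamming_weight n x \<le> n div 2 \<Longrightarrow> p x = of_bool (x = y)"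
      using interpolation_low[of n "n div 2" "\<lambda>x. of_bool (x = y)"] by blast
    \<comment> \<open>The factor \<open>2 ^ (k - 1) - Q\<close> exchanges the roles of the halves:
      on \<open>A\<close> it vanishes modulo \<open>2 ^ k\<close> at heavy points.\<close>
    have "[p x * (2 ^ (k - 1) + (-1) * Q x) = 2 ^ (k - 1) * of_bool (x = y)] (mod 2 ^ k)"
      if "x \<in> A" for x
    proof -
      have "p x * (2 ^ (k - 1) + (-1) * lift k (Maj n) x) = 2 ^ (k - 1) * of_bool (x = y)"
        using p(2)[of x] low[of x] False that A(1) by (auto simp: lift_def)
      moreover have "[p x * (2 ^ (k - 1) + (-1) * Q x) =
          p x * (2 ^ (k - 1) + (-1) * lift k (Maj n) x)] (mod 2 ^ k)"
        by (intro cong_mult cong_add cong_refl Q_cong that)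
      ultimately show ?thesis by simp
    qed
    then show ?thesis
      by (intro bexI[OF _ polyfun_mult[OF p(1) polyfun_add[OF polyfun_const polyfun_cmult[OF Q]]]])
         blast
  qed
  then obtain P where P: "P \<in> polyfun n (n div 2 + d)"
    and P_cong: "\<And>x. x \<in> A \<Longrightarrow> [P x = 2 ^ (k - 1) * of_bool (x = y)] (mod 2 ^ k)"
    by blast
  \<comment> \<open>Pairing with \<open>w\<close>: the left side is exactly 0, while the right side
    keeps only the term at \<open>y\<close>.\<close>
  have "[(\<Sum>x\<in>A. w x * P x) = (\<Sum>x\<in>A. w x * (2 ^ (k - 1) * of_bool (x = y)))] (mod 2 ^ k)"
    by (intro cong_sum cong_mult cong_refl P_cong)
  moreover have "(\<Sum>x\<in>A. w x * P x) = 0"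
    using polyfun_annihilated[OF w P A(1)] .
  moreover have "(\<Sum>x\<in>A. w x * (2 ^ (k - 1) * of_bool (x = y))) = 2 ^ (k - 1) * w y"
  proof -
    have "(\<Sum>x\<in>A. w x * (2 ^ (k - 1) * of_bool (x = y))) =
        (\<Sum>x\<in>A. if x = y then 2 ^ (k - 1) * w y else 0)"
      by (intro sum.cong) auto
    then show ?thesis using A(2) y(1) by simp
  qed
  ultimately have "2 ^ k dvd 2 ^ (k - 1) * w y"
    by (metis cong_0_iff cong_sym)
  moreover have "(2::int) ^ k = 2 ^ (k - 1) * 2"
    using k by (cases k) auto
  ultimately have "even (w y)" by simp
  with y(2) show False by simp
qed

section \<open>Partial sums of binomial coefficients\<close>

text \<open>Pascal's rule gives two summands, equal by symmetry.\<close>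

lemma central_binomial_Suc_eq: "2 * Suc m choose Suc m = 2 * (Suc (2 * m) choose m)"
  using binomial_symmetric[of m "Suc (2 * m)"] by simp

lemma central_binomial_Suc:
  "Suc m * (2 * Suc m choose Suc m) = 2 * (2 * m + 1) * (2 * m choose m)"
proof -
  have "Suc (2 * m) choose m = Suc (2 * m) choose Suc m"
    using binomial_symmetric[of m "Suc (2 * m)"] by simp
  then have "Suc m * (2 * Suc m choose Suc m) = 2 * ((Suc (2 * m) choose Suc m) * Suc m)"
    unfolding central_binomial_Suc_eq by (simp only: mult_ac)
  also have "\<dots> = 2 * (2 * m + 1) * (2 * m choose m)"
    unfolding Suc_times_binomial_eq[symmetric] by (simp only: mult_ac Suc_eq_plus1)
  finally show ?thesis .
qed

text \<open>Induction with the ratio of consecutive central coefficients, using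
  \<open>(2 * m + 1) * (2 * m + 3) = (2 * m + 2)^2 - 1\<close>. The factor \<open>2 * m + 1\<close>
  lets the induction close, which \<open>2 * m\<close> would not.\<close>

lemma central_binomial_square_le: "(2 * m choose m)\<^sup>2 * (2 * m + 1) \<le> 16 ^ m"
proof (induction m)
  case (Suc m)
  define B C where "B = 2 * m choose m" and "C = 2 * Suc m choose Suc m"
  have BC: "Suc m * C = 2 * (2 * m + 1) * B"
    unfolding B_def C_def by (rule central_binomial_Suc)
  have IH: "B\<^sup>2 * (2 * m + 1) \<le> 16 ^ m"
    using Suc.IH by (simp only: B_def)
  \<comment> \<open>The extra factor \<open>(Suc m)^2\<close> allows the recurrence to be used
    without division; it is cancelled at the end.\<close>
  have "(Suc m)\<^sup>2 * (C\<^sup>2 * (2 * Suc m + 1)) = (Suc m * C)\<^sup>2 * (2 * m + 3)"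
    unfolding power_mult_distrib by (simp add: algebra_simps)
  also have "\<dots> = (B\<^sup>2 * (2 * m + 1)) * (4 * (2 * m + 1) * (2 * m + 3))"
    unfolding BC by (simp add: power2_eq_square algebra_simps)
  also have "\<dots> \<le> 16 ^ m * (16 * (Suc m)\<^sup>2)"
    by (rule mult_mono[OF IH]) (simp_all add: power2_eq_square algebra_simps)
  finally have "(Suc m)\<^sup>2 * (C\<^sup>2 * (2 * Suc m + 1)) \<le> (Suc m)\<^sup>2 * 16 ^ Suc m"
    by (simp add: mult_ac)
  then have "C\<^sup>2 * (2 * Suc m + 1) \<le> 16 ^ Suc m"
    by (subst (asm) mult_le_cancel1) simp
  then show ?case by (simp only: C_def)
qed simp

text \<open>Even rows are central coefficients. In an odd row the middle coefficient is half of the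
  next central one.\<close>

lemma middle_binomial_square_le: "(n choose (n div 2))\<^sup>2 * n \<le> 4 ^ n"
proof (cases "even n")
  case True
  then obtain m where n: "n = 2 * m" by blast
  have "(2 * m choose m)\<^sup>2 * (2 * m) \<le> (2 * m choose m)\<^sup>2 * (2 * m + 1)" by simp
  also have "\<dots> \<le> 16 ^ m" by (rule central_binomial_square_le)
  finally show ?thesis by (simp add: n power_mult)
next
  case False
  then obtain m where n: "n = Suc (2 * m)" by (auto elim: oddE)
  define B where "B = Suc (2 * m) choose m"
  have "(2 * B)\<^sup>2 * (2 * Suc m + 1) \<le> 16 ^ Suc m"
    using central_binomial_square_le[of "Suc m"] unfolding central_binomial_Suc_eq B_def .
  moreover have "(2 * B)\<^sup>2 * (2 * Suc m + 1) = 4 * (B\<^sup>2 * Suc (2 * m)) + 8 * B\<^sup>2"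
    by (simp add: algebra_simps)
  moreover have "(16::nat) ^ Suc m = 4 * 4 ^ Suc (2 * m)"
    by (simp add: power_mult)
  ultimately have "B\<^sup>2 * Suc (2 * m) \<le> 4 ^ Suc (2 * m)"
    by linarith
  then show ?thesis by (simp add: n B_def)
qed

lemma middle_binomial_le:
  assumes "n \<ge> 1"
  shows "real (n choose (n div 2)) \<le> 2 ^ n / sqrt (real n)"
proof -
  have "real ((n choose (n div 2))\<^sup>2 * n) \<le> real (4 ^ n)"
    using middle_binomial_square_le[of n] of_nat_le_iff by blast
  moreover have "(2 ^ n)\<^sup>2 = (4::real) ^ n"
    by (simp add: power2_eq_square flip: power_mult_distrib)
  ultimately have "(real (n choose (n div 2)) * sqrt (real n))\<^sup>2 \<le> (2 ^ n)\<^sup>2"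
    by (simp add: power_mult_distrib)
  then have "real (n choose (n div 2)) * sqrt (real n) \<le> 2 ^ n"
    by (rule power2_le_imp_le) simp
  then show ?thesis using assms by (simp add: field_simps)
qed

text \<open>Reflecting \<open>i\<close> to \<open>n - i\<close> gives a second copy of the sum over
  the upper half; the two index ranges share at most the middle index, and only when
  \<open>n\<close> is even.\<close>

lemma sum_binomial_lower_half_le:
  "2 * (\<Sum>i\<le>n div 2. n choose i) \<le> 2 ^ n + (n choose (n div 2))"
proof -
  let ?m = "n div 2"
  have "(\<Sum>i\<le>?m. n choose i) = (\<Sum>i\<in>{n - ?m..n}. n choose i)"
    by (rule sum.reindex_bij_witness[of _ "\<lambda>i. n - i" "\<lambda>i. n - i"])
       (auto simp: binomial_symmetric[symmetric])
  then have "2 * (\<Sum>i\<le>?m. n choose i) = (\<Sum>i\<le>?m. n choose i) + (\<Sum>i\<in>{n - ?m..n}. n choose i)"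
    by simp
  also have "\<dots> = (\<Sum>i\<in>{..?m} \<union> {n - ?m..n}. n choose i) + (\<Sum>i\<in>{..?m} \<inter> {n - ?m..n}. n choose i)"
    by (rule sum.union_inter[symmetric]) auto
  also have "\<dots> \<le> (\<Sum>i\<le>n. n choose i) + (\<Sum>i\<in>{?m}. n choose i)"
    by (intro add_mono sum_mono2) auto
  also have "\<dots> = 2 ^ n + (n choose ?m)"
    by (simp add: choose_row_sum)
  finally show ?thesis .
qed

text \<open>Each of the \<open>d\<close> terms past the middle is at most the middle coefficient and
  counts twice.\<close>

lemma sum_binomial_upto_le:
  "2 * (\<Sum>i\<le>n div 2 + d. n choose i) \<le> 2 ^ n + (2 * d + 1) * (n choose (n div 2))"
proof (induction d)
  case 0
  then show ?case using sum_binomial_lower_half_le[of n] by simp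
next
  case (Suc d)
  then show ?case using binomial_maximum[of n "Suc (n div 2 + d)"] by (simp add: algebra_simps)
qed

section \<open>The bound for majority\<close>

lemma agr_Maj_le:
  assumes "n \<ge> 1" "k \<ge> 1" "d \<ge> 1" and c: "c \<in> mlpolys n d k"
  shows "agr n (lift k (Maj n)) (mleval n k c) \<le> 1 / 2 + 10 * real d / sqrt (real n)"
proof -
  let ?a = "card {x \<in> cube n. lift k (Maj n) x = mleval n k c x}"
  have "2 * ?a \<le> 2 ^ n + (2 * d + 1) * (n choose (n div 2))"
    using card_agreement_le[OF assms(2) c] sum_binomial_upto_le[of n d] by linarith
  then have "real (2 * ?a) \<le> real (2 ^ n + (2 * d + 1) * (n choose (n div 2)))"
    by (rule of_nat_mono)
  also have "\<dots> = 2 ^ n + (2 * real d + 1) * real (n choose (n div 2))"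
    by (simp add: algebra_simps)
  \<comment> \<open>Since \<open>d \<ge> 1\<close>, \<open>2 * d + 1 \<le> 20 * d\<close>; 20 is
    twice the constant 10 because the count is doubled here.\<close>
  also have "\<dots> \<le> 2 ^ n + (20 * real d) * (2 ^ n / sqrt (real n))"
    using middle_binomial_le[OF assms(1)] assms(3) by (intro add_mono mult_mono) auto
  finally have "real ?a \<le> (1 / 2 + 10 * real d / sqrt (real n)) * 2 ^ n"
    by (simp add: field_simps)
  moreover have "card (cube n) = 2 ^ n"
    by (simp add: cube_def card_PiE numeral_2_eq_2)
  ultimately show ?thesis
    by (simp add: agr_eq_card divide_le_eq)
qed

theorem theorem4p1:
  fixes n k d :: nat
  assumes "n \<ge> 1" and "k \<ge> 1" and "d \<ge> 1"
  shows "max_agr n d k (Maj n) \<le> 1 / 2 + 10 * real d / sqrt (real n)"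
  unfolding max_agr_def
  using agr_Maj_le[OF assms] by (simp add: finite_mlpolys mlpolys_nonempty)

end
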